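(* Let $M^3\subset M^4_K$ be a conformally flat hypersurface associated to a solution of Lamé's system (with Guichard condition) $l_i(\xi)$ with $\xi=\sum_{s=1}^3\alpha_sx_s$ and $\alpha_s\neq0$ for all $s$, given in terms of elliptic functions by $$l_{1,\xi}^2=c_2(c_2-c_1)\Big(l_1^2-\frac{\lambda}{c_2}\Big)\Big(l_1^2-\frac{\lambda}{c_2-c_1}\Big),\quad l_2^2=\frac{c_2}{c_1}\Big(l_1^2-\frac{\lambda}{c_2}\Big),\quad l_3^2=\frac{c_2-c_1}{c_1}\Big(l_1^2-\frac{\lambda}{c_2-c_1}\Big).$$ Then the Guichard net of $M^3$ is not cyclic.
   Context: Lamé's system with Guichard condition for positive functions $l_1,l_2,l_3$ of $(x_1,x_2,x_3)$: $l_1^2-l_2^2+l_3^2=0$ and, for $i,j,k$ distinct (subscripts after a comma are derivatives), $$l_{i,x_jx_k}-\frac{l_{i,x_j}l_{j,x_k}}{l_j}-\frac{l_{i,x_k}l_{k,x_j}}{l_k}=0,\qquad \Big(\frac{l_{i,x_j}}{l_j}\Big)_{,x_j}+\Big(\frac{l_{j,x_i}}{l_i}\Big)_{,x_i}+\frac{l_{i,x_k}l_{j,x_k}}{l_k^2}=0.$$ In the solutions considered none of $l_1,l_2,l_3$ is constant; the constants $c_1,c_2,c_3\in\mathbb{R}\setminus\{0\}$ are such that $l_{i,\xi}=c_il_jl_k$ for $i,j,k$ distinct, $c_1-c_2+c_3=0$, $\alpha_1^2c_2c_3+\alpha_2^2c_1c_3+\alpha_3^2c_1c_2=0$, and $\lambda\in\mathbb{R}$.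 Associated hypersurface: $M^4_K$ is a 4-dimensional space form of curvature $K$. By a theorem of Hertrich-Jeromin, each solution $(l_1,l_2,l_3)$ of Lamé's system with Guichard condition (a Guichard net: triply orthogonal coordinates $(x_1,x_2,x_3)$ of $\mathbb{R}^3$ with flat metric $\sum l_i^2dx_i^2$ and $l_1^2-l_2^2+l_3^2=0$) determines, up to conformal equivalence, a conformally flat hypersurface in $M^4_K$ with three distinct principal curvatures, with principal coordinates $(x_1,x_2,x_3)$ and induced metric $g=e^{2Q(x)}\sum_i l_i^2dx_i^2$ for some function $Q$. Cyclic: the metric can be written as $g=e^{2P(x)}\{\sin^2\varphi\,dx_1^2+dx_2^2+\cos^2\varphi\,dx_3^2\}$ (the roles of $\sin\varphi$ and $\cos\varphi$ may be exchanged by replacing $\varphi$ by $\pi/2-\varphi$) or as $g=e^{2\tilde P(x)}\{\sinh^2\tilde\varphi\,dx_1^2+\cosh^2\tilde\varphi\,dx_2^2+dx_3^2\}$. The Guichard net is cyclic if and only if $\varphi_{,x_1x_2}=\varphi_{,x_2x_3}=0$ when $g$ is of the first form, or $\tilde\varphi_{,x_1x_3}=\tilde\varphi_{,x_2x_3}=0$ when $g$ is of the second form (this is the characterization, due to Hertrich-Jeromin and Suyama, used as definition here). *)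

theory Defs
  imports "HOL-Analysis.Analysis"
begin

primrec Ck_on :: "nat \<Rightarrow> ('a::real_normed_vector \<Rightarrow> 'b::real_normed_vector) \<Rightarrow> 'a set \<Rightarrow> bool" where
  "Ck_on 0 f S \<longleftrightarrow> continuous_on S f"
| "Ck_on (Suc n) f S \<longleftrightarrow>
     f differentiable_on S \<and> (\<forall>v. Ck_on n (\<lambda>x. frechet_derivative f (at x) v) S)"

text \<open>Only used for open \<open>S\<close> and finite-dimensional domains, where it is the usual notion.\<close>

definition smooth_on :: "'a::real_normed_vector set \<Rightarrow> ('a \<Rightarrow> 'b::real_normed_vector) \<Rightarrow> bool" where
  "smooth_on S f \<longleftrightarrow> (\<forall>n. Ck_on n f S)"

definition pd :: "3 \<Rightarrow> (real^3 \<Rightarrow> 'b::real_normed_vector) \<Rightarrow> real^3 \<Rightarrow> 'b" where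
  "pd i F x = frechet_derivative F (at x) (axis i 1)"

definition lame_guichard :: "(real^3) set \<Rightarrow> (3 \<Rightarrow> real^3 \<Rightarrow> real) \<Rightarrow> bool" where
  "lame_guichard U L \<longleftrightarrow>
     (\<forall>i. smooth_on U (L i)) \<and>
     (\<forall>i. \<forall>x\<in>U. L i x > 0) \<and>
     (\<forall>x\<in>U. (L 1 x)\<^sup>2 - (L 2 x)\<^sup>2 + (L 3 x)\<^sup>2 = 0) \<and>
     (\<forall>x\<in>U. \<forall>i j k. distinct [i, j, k] \<longrightarrow>
        pd k (pd j (L i)) x
          - pd j (L i) x * pd k (L j) x / L j x
          - pd k (L i) x * pd j (L k) x / L k x = 0 \<and>
        pd j (\<lambda>y. pd j (L i) y / L j y) x
          + pd i (\<lambda>y. pd i (L j) y / L i y) x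
          + pd k (L i) x * pd k (L j) x / (L k x)\<^sup>2 = 0)"

text \<open>
  The space form of curvature \<open>K\<close> is realised in \<open>real \<times> (real^4)\<close> as the quadric
  \<open>t\<^sup>2 + K \<bar>y\<bar>\<^sup>2 = 1\<close>, with the metric induced by \<open>dt\<^sup>2 / K + \<bar>dy\<bar>\<^sup>2\<close>. Up to rescaling the coordinate
  \<open>t\<close> by the square root of \<open>\<bar>K\<bar>\<close>, this is the round sphere of radius \<open>1 / sqrt K\<close> in Euclidean
  5-space if \<open>K > 0\<close>, and one sheet of the hyperboloid \<open>\<langle>p, p\<rangle> = 1 / K\<close> in Lorentzian 5-space if
  \<open>K < 0\<close>. If \<open>K = 0\<close> it is the affine hyperplane \<open>t = 1\<close>, i.e. Euclidean 4-space.
\<close>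

type_synonym ambient = "real \<times> (real^4)"

definition space_form :: "real \<Rightarrow> ambient set" where
  "space_form K = {(t, y). t\<^sup>2 + K * (norm y)\<^sup>2 = 1 \<and> (K \<le> 0 \<longrightarrow> t > 0)}"

definition ambient_form :: "real \<Rightarrow> ambient \<Rightarrow> ambient \<Rightarrow> real" where
  "ambient_form K v w =
     (if K = 0 then 0 else fst v * fst w / K) + snd v \<bullet> snd w"

definition tangent_space :: "real \<Rightarrow> ambient \<Rightarrow> ambient set" where
  "tangent_space K p = {v. fst p * fst v + K * (snd p \<bullet> snd v) = 0}"

definition immersed_hypersurface :: "real \<Rightarrow> (real^3) set \<Rightarrow> (real^3 \<Rightarrow> ambient) \<Rightarrow> bool" where
  "immersed_hypersurface K U f \<longleftrightarrow>
     smooth_on U f \<and> f ` U \<subseteq> space_form K \<and> (\<forall>x\<in>U. inj (frechet_derivative f (at x)))"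

definition unit_normal ::
    "real \<Rightarrow> (real^3) set \<Rightarrow> (real^3 \<Rightarrow> ambient) \<Rightarrow> (real^3 \<Rightarrow> ambient) \<Rightarrow> bool" where
  "unit_normal K U f N \<longleftrightarrow>
     smooth_on U N \<and>
     (\<forall>x\<in>U. N x \<in> tangent_space K (f x) \<and> ambient_form K (N x) (N x) = 1 \<and>
            (\<forall>i. ambient_form K (pd i f x) (N x) = 0))"

type_synonym metric = "real^3 \<Rightarrow> 3 \<Rightarrow> 3 \<Rightarrow> real"

definition induced_metric :: "real \<Rightarrow> (real^3 \<Rightarrow> ambient) \<Rightarrow> metric" where
  "induced_metric K f x i j = ambient_form K (pd i f x) (pd j f x)"

text \<open>The position vector is orthogonal to \<open>N\<close>, so the flat second derivative may be used here.\<close>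

definition second_fundamental_form ::
    "real \<Rightarrow> (real^3 \<Rightarrow> ambient) \<Rightarrow> (real^3 \<Rightarrow> ambient) \<Rightarrow> metric" where
  "second_fundamental_form K f N x i j = ambient_form K (pd i (pd j f) x) (N x)"

text \<open>
  The equation says that the \<open>i\<close>-th coordinate field is an eigenvector of the shape operator with
  eigenvalue \<open>\<kappa> i\<close>; as the eigenvalues are distinct, both fundamental forms are diagonal.
\<close>

definition distinct_principal_coordinates ::
    "real \<Rightarrow> (real^3) set \<Rightarrow> (real^3 \<Rightarrow> ambient) \<Rightarrow> bool" where
  "distinct_principal_coordinates K U f \<longleftrightarrow>
     (\<exists>N. unit_normal K U f N \<and>
        (\<forall>x\<in>U. \<exists>\<kappa> :: 3 \<Rightarrow> real. inj \<kappa> \<and>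
           (\<forall>i j. second_fundamental_form K f N x i j = \<kappa> i * induced_metric K f x i j)))"

definition conformally_flat :: "(real^3) set \<Rightarrow> metric \<Rightarrow> bool" where
  "conformally_flat U g \<longleftrightarrow>
     (\<forall>p\<in>U. \<exists>V (u :: real^3 \<Rightarrow> real) (\<Phi> :: real^3 \<Rightarrow> real^3).
        open V \<and> p \<in> V \<and> V \<subseteq> U \<and> smooth_on V u \<and> smooth_on V \<Phi> \<and>
        (\<forall>x\<in>V. \<forall>i j. g x i j = exp (2 * u x) * (pd i \<Phi> x \<bullet> pd j \<Phi> x)))"

definition diag :: "real \<Rightarrow> real \<Rightarrow> real \<Rightarrow> 3 \<Rightarrow> 3 \<Rightarrow> real" where
  "diag a b c i j = (if i \<noteq> j then 0 else if i = 1 then a else if i = 2 then b else c)"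

definition associated_hypersurface ::
    "real \<Rightarrow> (real^3) set \<Rightarrow> (3 \<Rightarrow> real^3 \<Rightarrow> real) \<Rightarrow> (real^3 \<Rightarrow> ambient) \<Rightarrow> bool" where
  "associated_hypersurface K U L f \<longleftrightarrow>
     immersed_hypersurface K U f \<and>
     conformally_flat U (induced_metric K f) \<and>
     distinct_principal_coordinates K U f \<and>
     (\<exists>Q :: real^3 \<Rightarrow> real. smooth_on U Q \<and>
        (\<forall>x\<in>U. \<forall>i j. induced_metric K f x i j =
           exp (2 * Q x) * diag ((L 1 x)\<^sup>2) ((L 2 x)\<^sup>2) ((L 3 x)\<^sup>2) i j))"

definition trig_form ::
    "(real^3) set \<Rightarrow> metric \<Rightarrow> (real^3 \<Rightarrow> real) \<Rightarrow> (real^3 \<Rightarrow> real) \<Rightarrow> bool" where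
  "trig_form U g P \<phi> \<longleftrightarrow> smooth_on U P \<and> smooth_on U \<phi> \<and>
     (\<forall>x\<in>U. \<forall>i j. g x i j =
        exp (2 * P x) * diag ((sin (\<phi> x))\<^sup>2) 1 ((cos (\<phi> x))\<^sup>2) i j)"

definition hyp_form ::
    "(real^3) set \<Rightarrow> metric \<Rightarrow> (real^3 \<Rightarrow> real) \<Rightarrow> (real^3 \<Rightarrow> real) \<Rightarrow> bool" where
  "hyp_form U g P \<phi> \<longleftrightarrow> smooth_on U P \<and> smooth_on U \<phi> \<and>
     (\<forall>x\<in>U. \<forall>i j. g x i j =
        exp (2 * P x) * diag ((sinh (\<phi> x))\<^sup>2) ((cosh (\<phi> x))\<^sup>2) 1 i j)"

text \<open>The net is the coordinate system of \<open>U\<close>; the second argument is the induced metric.\<close>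

definition cyclic_net :: "(real^3) set \<Rightarrow> metric \<Rightarrow> bool" where
  "cyclic_net U g \<longleftrightarrow>
     (\<exists>P \<phi>. trig_form U g P \<phi> \<and>
        (\<forall>x\<in>U. pd 2 (pd 1 \<phi>) x = 0 \<and> pd 3 (pd 2 \<phi>) x = 0)) \<or>
     (\<exists>P \<phi>. hyp_form U g P \<phi> \<and>
        (\<forall>x\<in>U. pd 3 (pd 1 \<phi>) x = 0 \<and> pd 3 (pd 2 \<phi>) x = 0))"

end

theory Submission
  imports Defs
begin

text \<open>
  Comparing the two expressions of the metric gives \<open>sin\<^sup>2 \<phi> = (l\<^sub>1 / l\<^sub>2)\<^sup>2\<close>, respectively
  \<open>sinh\<^sup>2 \<phi> = (l\<^sub>1 / l\<^sub>3)\<^sup>2\<close>. Differentiating and using the first integrals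
  \<open>c\<^sub>1 l\<^sub>k\<^sup>2 - c\<^sub>k l\<^sub>1\<^sup>2 = -\<lambda>\<close> yields \<open>(\<phi>\<^sub>,\<^sub>i)\<^sup>2 = \<alpha>\<^sub>i\<^sup>2 \<lambda>\<^sup>2 / l\<^sub>k\<^sup>2\<close> with \<open>k = 2\<close>, respectively \<open>k = 3\<close>. Since
  \<open>l\<^sub>k\<close> has no critical point, the mixed derivatives of \<open>\<phi>\<close> vanish nowhere unless \<open>\<lambda> = 0\<close>.
  But \<open>\<lambda> = 0\<close> would force \<open>c\<^sub>1, c\<^sub>2, c\<^sub>3\<close> to have the same sign, contradicting
  \<open>\<alpha>\<^sub>1\<^sup>2 c\<^sub>2 c\<^sub>3 + \<alpha>\<^sub>2\<^sup>2 c\<^sub>1 c\<^sub>3 + \<alpha>\<^sub>3\<^sup>2 c\<^sub>1 c\<^sub>2 = 0\<close>.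
\<close>

lemma smooth_on_differentiable_at:
  assumes "smooth_on S F" "open S" "x \<in> S"
  shows "F differentiable (at x)"
proof -
  have "Ck_on (Suc 0) F S"
    using assms(1) unfolding smooth_on_def by blast
  then show ?thesis
    using assms(2,3) by (simp add: differentiable_on_eq_differentiable_at)
qed

text \<open>Smoothness at order two, read in the direction \<open>axis i 1\<close>; it allows the
  chain rule to be applied to \<open>pd i \<phi>\<close> itself.\<close>

lemma smooth_on_pd_differentiable_at:
  assumes "smooth_on S F" "open S" "x \<in> S"
  shows "pd i F differentiable (at x)"
proof -
  have "Ck_on (Suc (Suc 0)) F S"
    using assms(1) unfolding smooth_on_def by blast
  then have "(\<lambda>x. frechet_derivative F (at x) (axis i 1)) differentiable_on S"
    by simp
  then show ?thesis
    using assms(2,3) unfolding pd_def [abs_def]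
    by (simp add: differentiable_on_eq_differentiable_at)
qed

lemma pd_has_derivative:
  assumes "(F has_derivative F') (at x)"
  shows "pd i F x = F' (axis i 1)"
  using frechet_derivative_at [OF assms] by (simp add: pd_def)

lemma pd_chain:
  fixes F :: "real^3 \<Rightarrow> real"
  assumes "F differentiable (at x)" "(h has_real_derivative d) (at (F x))"
  shows "pd i (\<lambda>y. h (F y)) x = d * pd i F x"
proof -
  have "(F has_derivative frechet_derivative F (at x)) (at x)"
    using assms(1) frechet_derivative_works by blast
  then have "((\<lambda>y. h (F y)) has_derivative (\<lambda>v. d * frechet_derivative F (at x) v)) (at x)"
    using has_derivative_compose assms(2) unfolding has_field_derivative_def by blast
  then show ?thesis
    by (simp add: pd_has_derivative) (simp add: pd_def)
qed

lemma pd_cong_open: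
  assumes "open S" "x \<in> S" "\<And>y. y \<in> S \<Longrightarrow> F y = G y"
  shows "pd i F x = pd i G x"
proof -
  \<comment> \<open>\<open>frechet_derivative\<close> is a choice among all derivatives, so having
    the same derivatives forces the same choice.\<close>
  have "(F has_derivative D) (at x) \<longleftrightarrow> (G has_derivative D) (at x)" for D
    using assms has_derivative_transform_within_open [of F D x UNIV S G]
      has_derivative_transform_within_open [of G D x UNIV S F] by auto
  then show ?thesis
    by (simp add: pd_def frechet_derivative_def)
qed

text \<open>Instantiated with \<open>(S, C) = (sin, cos)\<close> and \<open>(S, C) = (sinh, cosh)\<close>.\<close>

lemma mixed_pd_nonzero:
  fixes \<xi> \<phi> :: "real^3 \<Rightarrow> real" and S C a b d :: "real \<Rightarrow> real"
  assumes U: "open U" "x \<in> U" "\<xi> ` U \<subseteq> I"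
    and \<xi>: "\<And>y. \<xi> differentiable (at y)" "\<And>s y. pd s \<xi> y = \<alpha> s"
    and \<phi>: "smooth_on U \<phi>"
    and S: "\<And>t. (S has_real_derivative C t) (at t)"
    and a: "\<And>s. s \<in> I \<Longrightarrow> a s > 0"
      "\<And>s. s \<in> I \<Longrightarrow> (a has_real_derivative p * b s * d s) (at s)"
    and b: "\<And>s. s \<in> I \<Longrightarrow> b s > 0"
    and d: "\<And>s. s \<in> I \<Longrightarrow> d s > 0"
      "\<And>s. s \<in> I \<Longrightarrow> (d has_real_derivative q * a s * b s) (at s)"
    and first_integral: "\<And>s. s \<in> I \<Longrightarrow> p * (d s)\<^sup>2 - q * (a s)\<^sup>2 = - lam"
    and SC: "\<And>y. y \<in> U \<Longrightarrow> (S (\<phi> y))\<^sup>2 = (a (\<xi> y) / d (\<xi> y))\<^sup>2"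
      "\<And>y. y \<in> U \<Longrightarrow> (C (\<phi> y))\<^sup>2 = (b (\<xi> y) / d (\<xi> y))\<^sup>2"
    and nz: "lam \<noteq> 0" "q \<noteq> 0" "\<alpha> i \<noteq> 0" "\<alpha> j \<noteq> 0"
  shows "pd j (pd i \<phi>) x \<noteq> 0"
proof -
  have sq: "(pd i \<phi> y)\<^sup>2 = (\<alpha> i * lam)\<^sup>2 / (d (\<xi> y))\<^sup>2" if y: "y \<in> U" for y
  proof -
    define A B D where "A = a (\<xi> y)" and "B = b (\<xi> y)" and "D = d (\<xi> y)"
    have s: "\<xi> y \<in> I" using U y by auto
    have pos: "A > 0" "B > 0" "D > 0"
      using a b d s by (auto simp: A_def B_def D_def)
    have "((\<lambda>t. (S t)\<^sup>2) has_real_derivative 2 * S (\<phi> y) * C (\<phi> y)) (at (\<phi> y))"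
      by (auto intro!: derivative_eq_intros S)
    then have l: "pd i (\<lambda>z. (S (\<phi> z))\<^sup>2) y = 2 * S (\<phi> y) * C (\<phi> y) * pd i \<phi> y"
      using pd_chain [of \<phi> y "\<lambda>t. (S t)\<^sup>2"] smooth_on_differentiable_at [OF \<phi> U(1) y] by blast
    have "((\<lambda>s. (a s / d s)\<^sup>2) has_real_derivative
        2 * (A / D) * ((p * B * D * D - A * (q * A * B)) / (D * D))) (at (\<xi> y))"
      using pos unfolding A_def B_def D_def
      by (auto intro!: derivative_eq_intros a(2) d(2) s simp: mult_ac)
    \<comment> \<open>This is the numerator from the quotient rule; the first integral turns the
      bracket on the right into the constant \<open>- lam\<close>.\<close>
    moreover have "p * B * D * D - A * (q * A * B) = B * (p * D\<^sup>2 - q * A\<^sup>2)"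
      by (simp add: algebra_simps power2_eq_square)
    ultimately have "((\<lambda>s. (a s / d s)\<^sup>2) has_real_derivative
        2 * (A / D) * (B * (- lam) / (D * D))) (at (\<xi> y))"
      using first_integral [OF s] by (simp add: A_def D_def)
    then have r: "pd i (\<lambda>z. (a (\<xi> z) / d (\<xi> z))\<^sup>2) y = 2 * (A / D) * (B * (- lam) / (D * D)) * \<alpha> i"
      using pd_chain [of \<xi> y "\<lambda>s. (a s / d s)\<^sup>2"] \<xi> by simp
    have "S (\<phi> y) * C (\<phi> y) * pd i \<phi> y = (A / D) * (B * (- lam) / (D * D)) * \<alpha> i"
      using l r pd_cong_open [OF U(1) y SC(1), where i = i] by simp
    \<comment> \<open>Squaring removes the unknown signs: \<open>SC\<close> determines
      \<open>S (\<phi> y)\<close> and \<open>C (\<phi> y)\<close> only up to sign.\<close>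
    then have "(S (\<phi> y))\<^sup>2 * (C (\<phi> y))\<^sup>2 * (pd i \<phi> y)\<^sup>2 = ((A / D) * (B * (- lam) / (D * D)) * \<alpha> i)\<^sup>2"
      by (metis power_mult_distrib)
    then have "(A / D)\<^sup>2 * (B / D)\<^sup>2 * (pd i \<phi> y)\<^sup>2 = (A / D)\<^sup>2 * (B / D)\<^sup>2 * ((\<alpha> i * lam)\<^sup>2 / D\<^sup>2)"
      unfolding SC [OF y] by (simp add: A_def B_def D_def power2_eq_square mult_ac)
    moreover have "(A / D)\<^sup>2 * (B / D)\<^sup>2 \<noteq> 0" using pos by simp
    ultimately show ?thesis
      unfolding D_def by (metis mult_left_cancel)
  qed
  have s: "\<xi> x \<in> I" using U by auto
  have pos: "a (\<xi> x) > 0" "b (\<xi> x) > 0" "d (\<xi> x) > 0"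
    using a b d s by auto
  have "((\<lambda>t::real. t\<^sup>2) has_real_derivative 2 * pd i \<phi> x) (at (pd i \<phi> x))"
    by (auto intro!: derivative_eq_intros)
  then have l: "pd j (\<lambda>z. (pd i \<phi> z)\<^sup>2) x = 2 * pd i \<phi> x * pd j (pd i \<phi>) x"
    using pd_chain [of "pd i \<phi>" x "\<lambda>t. t\<^sup>2"] smooth_on_pd_differentiable_at [OF \<phi> U(1,2)] by blast
  \<comment> \<open>The quotient rule for \<open>(\<alpha> i * lam)\<^sup>2 / (d s)\<^sup>2\<close>,
    with \<open>q * a s * b s\<close> as the derivative of \<open>d\<close>. Every factor is
    nonzero, hence so is \<open>e\<close>.\<close>
  define e where "e = - ((\<alpha> i * lam)\<^sup>2 * (2 * d (\<xi> x) * (q * a (\<xi> x) * b (\<xi> x)))) / ((d (\<xi> x))\<^sup>2 * (d (\<xi> x))\<^sup>2)"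
  have "((\<lambda>s. (\<alpha> i * lam)\<^sup>2 / (d s)\<^sup>2) has_real_derivative e) (at (\<xi> x))"
    using pos unfolding e_def
    by (auto intro!: derivative_eq_intros d(2) s)
  then have r: "pd j (\<lambda>z. (\<alpha> i * lam)\<^sup>2 / (d (\<xi> z))\<^sup>2) x = e * \<alpha> j"
    using pd_chain [of \<xi> x "\<lambda>s. (\<alpha> i * lam)\<^sup>2 / (d s)\<^sup>2"] \<xi> by simp
  have "e * \<alpha> j \<noteq> 0"
    using nz pos by (simp add: e_def)
  \<comment> \<open>Differentiating \<open>sq\<close> makes
    \<open>2 * pd i \<phi> x * pd j (pd i \<phi>) x\<close> equal to \<open>e * \<alpha> j\<close>,
    so neither factor can vanish.\<close>
  then show ?thesis
    using l r pd_cong_open [OF U(1,2) sq, where i = j] by auto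
qed

theorem corollary2:
  fixes K lam :: real
    and c \<alpha> :: "3 \<Rightarrow> real"
    and I :: "real set"
    and l :: "3 \<Rightarrow> real \<Rightarrow> real"
    and U :: "(real^3) set"
    and \<xi> :: "real^3 \<Rightarrow> real"
    and f :: "real^3 \<Rightarrow> real \<times> (real^4)"
  assumes I: "open I" "is_interval I"
    and l_smooth: "\<And>i. smooth_on I (l i)"
    and l_pos: "\<And>i s. s \<in> I \<Longrightarrow> l i s > 0"
    and l_nonconst: "\<And>i. \<not> l i constant_on I"
    and c_nonzero: "\<And>i. c i \<noteq> 0"
    and l_deriv: "\<And>i j k s. distinct [i, j, k] \<Longrightarrow> s \<in> I \<Longrightarrow> deriv (l i) s = c i * l j s * l k s"
    and c_sum: "c 1 - c 2 + c 3 = 0"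
    and c_alpha: "(\<alpha> 1)\<^sup>2 * c 2 * c 3 + (\<alpha> 2)\<^sup>2 * c 1 * c 3 + (\<alpha> 3)\<^sup>2 * c 1 * c 2 = 0"
    and alpha_nonzero: "\<And>s. \<alpha> s \<noteq> 0"
    and l1: "\<And>s. s \<in> I \<Longrightarrow> (deriv (l 1) s)\<^sup>2 =
               c 2 * (c 2 - c 1) * ((l 1 s)\<^sup>2 - lam / c 2) * ((l 1 s)\<^sup>2 - lam / (c 2 - c 1))"
    and l2: "\<And>s. s \<in> I \<Longrightarrow> (l 2 s)\<^sup>2 = c 2 / c 1 * ((l 1 s)\<^sup>2 - lam / c 2)"
    and l3: "\<And>s. s \<in> I \<Longrightarrow> (l 3 s)\<^sup>2 = (c 2 - c 1) / c 1 * ((l 1 s)\<^sup>2 - lam / (c 2 - c 1))"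
    and xi: "\<And>x. \<xi> x = (\<Sum>s\<in>UNIV. \<alpha> s * x $ s)"
    and U: "open U" "U \<noteq> {}" "\<xi> ` U \<subseteq> I"
    and lame: "lame_guichard U (\<lambda>i x. l i (\<xi> x))"
    and hyp: "associated_hypersurface K U (\<lambda>i x. l i (\<xi> x)) f"
  shows "\<not> cyclic_net U (induced_metric K f)"
proof
  assume cyc: "cyclic_net U (induced_metric K f)"
  have l_DERIV: "(l i has_real_derivative c i * l j s * l k s) (at s)"
    if "distinct [i, j, k]" "s \<in> I" for i j k s
    using smooth_on_differentiable_at [OF l_smooth I(1) that(2)] l_deriv [OF that]
    by (metis DERIV_deriv_iff_real_differentiable)
  have \<xi>_deriv: "(\<xi> has_derivative (\<lambda>v. \<Sum>s\<in>UNIV. \<alpha> s * v $ s)) (at y)" for y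
    unfolding xi [abs_def]
    by (intro has_derivative_sum has_derivative_mult_right bounded_linear_imp_has_derivative
        bounded_linear_vec_nth)
  have pd_\<xi>: "pd s \<xi> y = \<alpha> s" for s y
    using pd_has_derivative [OF \<xi>_deriv, of s y] by (simp add: axis_def if_distrib cong: if_cong)
  have \<xi>_diff: "\<xi> differentiable (at y)" for y
    using \<xi>_deriv differentiable_def by blast
  obtain x where x: "x \<in> U" using U(2) by blast
  have xI: "\<xi> y \<in> I" if "y \<in> U" for y using U(3) that by auto
  have c3: "c 3 = c 2 - c 1" using c_sum by simp
  \<comment> \<open>Clearing denominators in \<open>l2\<close> and \<open>l3\<close> gives two first
    integrals with the same constant \<open>lam\<close>.\<close>
  have int2: "c 1 * (l 2 s)\<^sup>2 - c 2 * (l 1 s)\<^sup>2 = - lam" if "s \<in> I" for s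
    using l2 [OF that] c_nonzero [of 1] c_nonzero [of 2] by (simp add: right_diff_distrib)
  have int3: "c 1 * (l 3 s)\<^sup>2 - c 3 * (l 1 s)\<^sup>2 = - lam" if "s \<in> I" for s
    using l3 [OF that, folded c3] c_nonzero [of 1] c_nonzero [of 3] by (simp add: right_diff_distrib)
  have lam: "lam \<noteq> 0"
  proof
    assume "lam = 0"
    define s where "s = \<xi> x"
    have s: "s \<in> I" using xI x s_def by blast
    have eq: "c 1 * (l 2 s)\<^sup>2 = c 2 * (l 1 s)\<^sup>2" "c 1 * (l 3 s)\<^sup>2 = c 3 * (l 1 s)\<^sup>2"
      using int2 [OF s] int3 [OF s] \<open>lam = 0\<close> by auto
    have sq: "(l i s)\<^sup>2 > 0" for i using l_pos [OF s, of i] by simp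
    \<comment> \<open>The extra factor \<open>c 1\<close> makes the right-hand sides positive
      squares, so \<open>c 2\<close> and \<open>c 3\<close> both share the sign of
      \<open>c 1\<close>.\<close>
    have "c 1 * c 2 * (l 1 s)\<^sup>2 = (c 1)\<^sup>2 * (l 2 s)\<^sup>2" "c 1 * c 3 * (l 1 s)\<^sup>2 = (c 1)\<^sup>2 * (l 3 s)\<^sup>2"
      using eq by (simp_all add: power2_eq_square mult_ac)
    then have pos: "c 1 * c 2 > 0" "c 1 * c 3 > 0"
      using sq c_nonzero by (metis mult_pos_pos zero_less_mult_pos2 zero_less_power2)+
    then have "c 2 * c 3 > 0"
      by (auto simp: zero_less_mult_iff)
    then have "(\<alpha> 1)\<^sup>2 * (c 2 * c 3) + (\<alpha> 2)\<^sup>2 * (c 1 * c 3) + (\<alpha> 3)\<^sup>2 * (c 1 * c 2) > 0"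
      using pos alpha_nonzero by (intro add_pos_pos mult_pos_pos [of "(\<alpha> _)\<^sup>2"]) auto
    then show False using c_alpha by (simp add: mult.assoc)
  qed
  obtain Q where Q: "\<And>y i j. y \<in> U \<Longrightarrow> induced_metric K f y i j =
      exp (2 * Q y) * diag ((l 1 (\<xi> y))\<^sup>2) ((l 2 (\<xi> y))\<^sup>2) ((l 3 (\<xi> y))\<^sup>2) i j"
    using hyp unfolding associated_hypersurface_def by blast
  \<comment> \<open>Eliminates the conformal factors: \<open>E\<close> and \<open>F\<close> stand
    for \<open>exp (2 * Q y)\<close> and \<open>exp (2 * P y)\<close>, and the diagonal entry
    normalised to \<open>1\<close> supplies the denominator \<open>w\<close>.\<close>
  have ratio: "u = (v / w)\<^sup>2" if "E * v\<^sup>2 = F * u" "E * w\<^sup>2 = F * 1" "E > 0" "w > 0"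
    for E F u v w :: real
  proof -
    have "E * v\<^sup>2 = E * (w\<^sup>2 * u)" using that by (simp add: mult.assoc [symmetric])
    then have "v\<^sup>2 = w\<^sup>2 * u" using that(3) by simp
    then show ?thesis using that(4) by (simp add: power_divide)
  qed
  from cyc consider
    (trig) P \<phi> where "trig_form U (induced_metric K f) P \<phi>" "pd 2 (pd 1 \<phi>) x = 0"
  | (hyp) P \<phi> where "hyp_form U (induced_metric K f) P \<phi>" "pd 3 (pd 1 \<phi>) x = 0"
    unfolding cyclic_net_def using x by blast
  then show False
  proof cases
    case trig
    have smooth: "smooth_on U \<phi>" using trig(1) unfolding trig_form_def by blast
    have g: "exp (2 * Q y) * diag ((l 1 (\<xi> y))\<^sup>2) ((l 2 (\<xi> y))\<^sup>2) ((l 3 (\<xi> y))\<^sup>2) i i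
        = exp (2 * P y) * diag ((sin (\<phi> y))\<^sup>2) 1 ((cos (\<phi> y))\<^sup>2) i i" if "y \<in> U" for y i
      using trig(1) Q [OF that, of i i] that unfolding trig_form_def by metis
    have SC: "(sin (\<phi> y))\<^sup>2 = (l 1 (\<xi> y) / l 2 (\<xi> y))\<^sup>2" "(cos (\<phi> y))\<^sup>2 = (l 3 (\<xi> y) / l 2 (\<xi> y))\<^sup>2"
      if "y \<in> U" for y
      using g [OF that, of 1] g [OF that, of 2] g [OF that, of 3] l_pos [OF xI [OF that], of 2]
      by (auto simp: diag_def intro!: ratio [of "exp (2 * Q y)" _ "exp (2 * P y)"])
    \<comment> \<open>The second entry is the normalised one, so \<open>l 2\<close> is the
      denominator; \<open>p\<close> and \<open>q\<close> are the coefficients in the derivatives of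
      \<open>l 1\<close> and \<open>l 2\<close>.\<close>
    have "pd 2 (pd 1 \<phi>) x \<noteq> 0"
      by (rule mixed_pd_nonzero [where S = sin and C = cos and a = "l 1" and b = "l 3" and d = "l 2"
            and p = "c 1" and q = "c 2", OF U(1) x U(3) \<xi>_diff pd_\<xi> smooth DERIV_sin
            l_pos l_DERIV l_pos l_pos l_DERIV int2 SC lam c_nonzero alpha_nonzero alpha_nonzero])
        auto
    then show False using trig(2) by blast
  next
    case hyp
    have smooth: "smooth_on U \<phi>" using hyp(1) unfolding hyp_form_def by blast
    have g: "exp (2 * Q y) * diag ((l 1 (\<xi> y))\<^sup>2) ((l 2 (\<xi> y))\<^sup>2) ((l 3 (\<xi> y))\<^sup>2) i i
        = exp (2 * P y) * diag ((sinh (\<phi> y))\<^sup>2) ((cosh (\<phi> y))\<^sup>2) 1 i i" if "y \<in> U" for y i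
      using hyp(1) Q [OF that, of i i] that unfolding hyp_form_def by metis
    have SC: "(sinh (\<phi> y))\<^sup>2 = (l 1 (\<xi> y) / l 3 (\<xi> y))\<^sup>2" "(cosh (\<phi> y))\<^sup>2 = (l 2 (\<xi> y) / l 3 (\<xi> y))\<^sup>2"
      if "y \<in> U" for y
      using g [OF that, of 1] g [OF that, of 2] g [OF that, of 3] l_pos [OF xI [OF that], of 3]
      by (auto simp: diag_def intro!: ratio [of "exp (2 * Q y)" _ "exp (2 * P y)"])
    have DERIV_sinh: "(sinh has_real_derivative cosh t) (at t)" for t :: real
      by (auto intro!: derivative_eq_intros)
    \<comment> \<open>Now the third entry is normalised: \<open>l 2\<close> and \<open>l 3\<close>
      exchange roles, and \<open>int3\<close> is the matching first integral.\<close>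
    have "pd 3 (pd 1 \<phi>) x \<noteq> 0"
      by (rule mixed_pd_nonzero [where S = sinh and C = cosh and a = "l 1" and b = "l 2" and d = "l 3"
            and p = "c 1" and q = "c 3", OF U(1) x U(3) \<xi>_diff pd_\<xi> smooth DERIV_sinh
            l_pos l_DERIV l_pos l_pos l_DERIV int3 SC lam c_nonzero alpha_nonzero alpha_nonzero])
        auto
    then show False using hyp(2) by blast
  qed
qed

end
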